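(* For all integers $n > k \ge 0$ such that $n$ is a power of two, we have \[ g\left(n,k,k^{\log_2 3}\right) \le n^{\log_2 3}. \]
   Context: For a finite set $A\subset\mathbb{R}$, the difference set is $A-A=\{a-a' : a,a'\in A\}$ (so it includes $0$ and negative differences). For integers $n,k$ and a real number $\ell$, $g(n,k,\ell)$ denotes the minimum of $|A-A|$ over all sets $A$ of $n$ real numbers with the property that every subset $A'\subset A$ of size $k$ satisfies $|A'-A'|\ge \ell$. *)

theory Defs
  imports Complex_Main "HOL-Library.Extended_Real"
begin

definition difference_set :: "real set \<Rightarrow> real set" where
  "difference_set A = {a - a' | a a'. a \<in> A \<and> a' \<in> A}"

definition admissible :: "nat \<Rightarrow> nat \<Rightarrow> real \<Rightarrow> real set \<Rightarrow> bool" where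
  "admissible n k l A \<longleftrightarrow>
     finite A \<and> card A = n \<and>
     (\<forall>A'. A' \<subseteq> A \<and> card A' = k \<longrightarrow> l \<le> real (card (difference_set A')))"

(* The value lies in enat so that the minimum over an empty family is infinity rather than
   the infimum 0 of type nat; over a nonempty family the infimum is attained, so it is the
   minimum. *)
definition g :: "nat \<Rightarrow> nat \<Rightarrow> real \<Rightarrow> enat" where
  "g n k l = (INF A \<in> {A. admissible n k l A}. enat (card (difference_set A)))"

end

theory Submission
  imports Defs "HOL-Analysis.Convex" "HOL-Real_Asymp.Real_Asymp"
begin

text \<open>Take for \<open>A\<close> the subset sums of \<open>1, 3, \<dots>, 3 ^ (m - 1)\<close>, where \<open>n = 2 ^ m\<close>. By induction on
  \<open>m\<close>, splitting on the top ternary digit, \<open>\<bar>X - Y\<bar> \<ge> (\<bar>X\<bar> \<bar>Y\<bar>) ^ p\<close> for all \<open>X, Y \<subseteq> A\<close>, where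
  \<open>p = log 2 3 / 2\<close>; the induction step is Woodall's inequality
  \<open>((a + b) (c + d)) ^ p \<le> (a c) ^ p + (b d) ^ p + (b c) ^ p\<close> for \<open>a d \<le> b c\<close>. With \<open>x = b / a\<close> and
  \<open>y = d / c\<close>, the logarithm of the ratio of the two sides is unimodal in \<open>y \<in> [0, x]\<close>, so it suffices
  to check the endpoints. The case \<open>y = x\<close> with \<open>x = exp (2 t)\<close> becomes
  \<open>3 (cosh t) ^ q \<le> 1 + 2 cosh (q t)\<close> with \<open>q = 2 p\<close>, where the logarithm of the ratio vanishes at
  \<open>t = 0\<close> and at infinity and is again unimodal in between.\<close>

section \<open>The hyperbolic inequality behind the diagonal case\<close>

lemma log_2_3_bounds: "1 < log 2 (3::real)" "log 2 (3::real) < 5/3"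
proof -
  show "1 < log 2 (3::real)" by simp
  \<comment> \<open>The bound 5/3 comes from 27 < 32.\<close>
  have "3 * log 2 (3::real) = log 2 (3 ^ 3)" by (subst log_nat_power) auto
  also have "\<dots> < log 2 (2 ^ 5)" by (subst log_less_cancel_iff) auto
  also have "\<dots> = 5" by (subst log_nat_power) auto
  finally show "log 2 (3::real) < 5/3" by simp
qed

text \<open>As r < 2/3 gives 2 r^2 \<le> 1, the function 2 sinh (r t) - sinh t is concave for t
  \<ge> 0. It vanishes at 0, so once nonnegative at t it lies above the chord from 0 to t, which is
  nonnegative. Hence its sign can only change from plus to minus.\<close>

lemma two_sinh_minus_sinh_sign:
  fixes r s t :: real
  assumes r: "0 < r" "r < 2/3" and st: "0 < s" "s \<le> t" and t: "0 \<le> 2 * sinh (r * t) - sinh t"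
  shows "0 \<le> 2 * sinh (r * s) - sinh s"
proof -
  define D where "D = (\<lambda>t. 2 * sinh (r * t) - sinh t)"
  have "concave_on {0..} D"
  proof (rule f''_le0_imp_concave)
    show "(D has_real_derivative 2 * r * cosh (r * x) - cosh x) (at x)" for x
      unfolding D_def by (auto intro!: derivative_eq_intros)
    show "((\<lambda>x. 2 * r * cosh (r * x) - cosh x) has_real_derivative
        2 * r^2 * sinh (r * x) - sinh x) (at x)" for x
      by (auto intro!: derivative_eq_intros simp: power2_eq_square)
    fix x :: real assume "x \<in> {0..}"
    then have x: "0 \<le> x" by simp
    have "r * x \<le> 1 * x" using r x by (intro mult_right_mono) auto
    then have a: "0 \<le> sinh (r * x)" "sinh (r * x) \<le> sinh x" using r x by auto
    have "r * r \<le> (2/3) * (2/3)" using r by (intro mult_mono) auto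
    then have "2 * r^2 \<le> 1" by (simp add: power2_eq_square)
    then have "2 * r^2 * sinh (r * x) \<le> 1 * sinh x" using a by (intro mult_mono) auto
    then show "2 * r^2 * sinh (r * x) - sinh x \<le> 0" by simp
  qed auto
  then have "(1 - s/t) * D 0 + (s/t) * D t \<le> D ((1 - s/t) *\<^sub>R 0 + (s/t) *\<^sub>R t)"
    using st by (intro concave_onD) auto
  moreover have "0 \<le> (s/t) * D t" using t st by (auto simp: D_def)
  ultimately show ?thesis using st by (simp add: D_def)
qed

lemma cosh_powr_log_2_3_le:
  fixes t :: real
  shows "3 * cosh t powr log 2 3 \<le> 1 + 2 * cosh (log 2 3 * t)"
proof -
  define q :: real where "q = log 2 3"
  note q = log_2_3_bounds[folded q_def]
  define f where "f = (\<lambda>t. ln (1 + 2 * cosh (q * t)) - q * ln (cosh t) - ln 3)"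
  define D where "D = (\<lambda>t. 2 * sinh ((q - 1) * t) - sinh t)"
  have pos: "0 < 1 + 2 * cosh (q * t)" for t :: real
    using cosh_real_pos[of "q * t"] by linarith
  have deriv: "(f has_real_derivative q * D t / ((1 + 2 * cosh (q * t)) * cosh t)) (at t)" for t
  proof -
    have "(f has_real_derivative 2 * (sinh (q * t) * q) / (1 + 2 * cosh (q * t))
        - q * (sinh t / cosh t)) (at t)"
      unfolding f_def using pos[of t] by (auto intro!: derivative_eq_intros simp: field_simps)
    \<comment> \<open>The numerator of the derivative collapses to \<open>D t\<close> by the
      subtraction formula for sinh at q t - t, so \<open>D\<close> governs the sign of the
      derivative of \<open>f\<close>.\<close>
    moreover have "D t = 2 * sinh (q * t) * cosh t - (1 + 2 * cosh (q * t)) * sinh t"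
      unfolding D_def by (simp add: left_diff_distrib sinh_diff algebra_simps)
    ultimately show ?thesis using pos[of t] by (simp add: divide_simps) (simp add: algebra_simps)
  qed
  have f0: "f 0 = 0" by (simp add: f_def)
  have Dmono: "0 \<le> D s" if "0 < s" "s \<le> t" "0 \<le> D t" for s t
    using two_sinh_minus_sinh_sign[of "q - 1" s t] that q by (auto simp: D_def)
  \<comment> \<open>If \<open>D t\<close> is nonnegative, \<open>f\<close> increases on [0, t] from
    \<open>f 0 = 0\<close>. Otherwise \<open>f\<close> decreases from t on, and \<open>f t\<close>
    is bounded below by the limit at infinity.\<close>
  have nonneg: "0 \<le> f t" if t: "0 < t" for t
  proof (cases "0 \<le> D t")
    case True
    have "f 0 \<le> f t"
    proof (rule DERIV_nonneg_imp_increasing_open[where f = f])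
      show "0 \<le> t" using t by simp
      show "\<exists>y. (f has_real_derivative y) (at x) \<and> 0 \<le> y" if "0 < x" "x < t" for x
        using deriv[of x] Dmono[of x t] that True pos[of x] q
        by (intro exI[of _ "q * D x / ((1 + 2 * cosh (q * x)) * cosh x)"]) auto
      show "continuous_on {0..t} f"
        by (rule continuous_at_imp_continuous_on) (use deriv DERIV_isCont in blast)
    qed
    then show ?thesis using f0 by simp
  next
    case False
    have le: "f u \<le> f t" if "t \<le> u" for u
    proof (rule DERIV_nonpos_imp_nonincreasing[OF that])
      fix x assume "t \<le> x" "x \<le> u"
      then have "D x \<le> 0" using Dmono[of t x] t False by linarith
      then have "q * D x / ((1 + 2 * cosh (q * x)) * cosh x) \<le> 0"
        using pos[of x] q by (intro divide_nonpos_nonneg mult_nonneg_nonpos) auto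
      then show "\<exists>y. (f has_real_derivative y) (at x) \<and> y \<le> 0"
        using deriv by blast
    qed
    \<comment> \<open>Keeping only exp (q u) from 1 + 2 cosh (q u) gives a minorant of
      \<open>f\<close> whose limit is easy to compute.\<close>
    have low: "q * (u - ln (cosh u)) - ln 3 \<le> f u" for u
    proof -
      have "exp (q * u) \<le> 1 + 2 * cosh (q * u)"
        using exp_ge_zero[of "- (q * u)"] by (simp add: cosh_def add_divide_distrib del: exp_ge_zero)
      then have "ln (exp (q * u)) \<le> ln (1 + 2 * cosh (q * u))"
        using pos[of u] by (subst ln_le_cancel_iff) auto
      then show ?thesis by (simp add: f_def algebra_simps)
    qed
    have "((\<lambda>u::real. u - ln (cosh u)) \<longlongrightarrow> ln 2) at_top"
      unfolding cosh_field_def by (real_asymp simp: ln_div)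
    then have "((\<lambda>u. q * (u - ln (cosh u)) - ln 3) \<longlongrightarrow> q * ln 2 - ln 3) at_top"
      by (intro tendsto_intros)
    \<comment> \<open>The limit is exactly 0 because 2 to the power q is 3.\<close>
    moreover have "q * ln 2 - ln 3 = 0" by (simp add: q_def log_def)
    ultimately have "((\<lambda>u. q * (u - ln (cosh u)) - ln 3) \<longlongrightarrow> 0) at_top" by simp
    moreover have "\<forall>\<^sub>F u in at_top. q * (u - ln (cosh u)) - ln 3 \<le> f t"
      using eventually_ge_at_top[of t] by eventually_elim (use le low order_trans in blast)
    ultimately show ?thesis
      by (intro tendsto_upperbound) auto
  qed
  have "f t = f \<bar>t\<bar>" by (cases "t \<ge> 0") (auto simp: f_def)
  then have "0 \<le> f t" using nonneg[of "\<bar>t\<bar>"] f0 by (cases "t = 0") auto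
  then have "exp (ln 3 + q * ln (cosh t)) \<le> exp (ln (1 + 2 * cosh (q * t)))"
    by (subst exp_le_cancel_iff) (simp add: f_def)
  then show ?thesis
    unfolding q_def[symmetric] using pos[of t] by (simp add: exp_add powr_def)
qed

text \<open>The substitution x = exp (2 t) symmetrizes both sides: 1 + x = 2 exp t cosh t, and a
  common factor exp (q t) cancels.\<close>

lemma one_plus_powr_log_2_3_le:
  fixes x :: real
  assumes x: "0 < x"
  shows "(1 + x) powr log 2 3 \<le> 1 + x powr (log 2 3 / 2) + x powr log 2 3"
proof -
  define t where "t = ln x / 2"
  define q :: real where "q = log 2 3"
  have xt: "x = exp (2 * t)" using x by (simp add: t_def)
  have "1 + x = 2 * (exp t * cosh t)"
    unfolding xt by (simp add: cosh_def algebra_simps flip: exp_add)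
  then have "(1 + x) powr q = 2 powr q * (exp t powr q * cosh t powr q)"
    by (simp add: powr_mult)
  also have "\<dots> = exp (q * t) * (3 * cosh t powr q)"
    by (simp add: q_def powr_def[of "exp t"])
  also have "\<dots> \<le> exp (q * t) * (1 + 2 * cosh (q * t))"
    using cosh_powr_log_2_3_le[of t] by (simp add: q_def)
  also have "\<dots> = 1 + x powr (q / 2) + x powr q"
    unfolding xt by (simp add: cosh_def powr_def algebra_simps flip: exp_add)
  finally show ?thesis by (simp add: q_def)
qed

section \<open>Woodall's inequality\<close>

lemma add_powr_le:
  fixes x y p :: real
  assumes "0 \<le> x" "0 \<le> y" "0 \<le> p" "p \<le> 1"
  shows "(x + y) powr p \<le> x powr p + y powr p"
proof (cases "x + y = 0")
  case False
  define s where "s = x + y"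
  have s: "0 < s" using False assms by (simp add: s_def)
  \<comment> \<open>After scaling the sum to 1, subadditivity follows from z \<le> z^p on
    [0, 1].\<close>
  have *: "z / s \<le> (z / s) powr p" if "0 \<le> z" "z \<le> s" for z
    using powr_mono'[of p 1 "z / s"] that s assms by simp
  have "1 = x / s + y / s" using s by (simp add: s_def flip: add_divide_distrib)
  also have "\<dots> \<le> (x / s) powr p + (y / s) powr p"
    using assms by (intro add_mono *) (auto simp: s_def)
  also have "\<dots> = (x powr p + y powr p) / s powr p"
    using assms s by (simp add: powr_divide add_divide_distrib)
  finally show ?thesis using s by (simp add: s_def field_simps)
qed (use assms in auto)

lemma woodall_normalized:
  fixes x y :: real
  defines "p \<equiv> log 2 3 / 2"
  assumes y: "0 \<le> y" "y \<le> x"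
  shows "((1 + x) * (1 + y)) powr p \<le> 1 + x powr p + (x * y) powr p"
proof (cases "y = 0")
  case True
  then show ?thesis
    using add_powr_le[of 1 x p] log_2_3_bounds y by (simp add: p_def)
next
  case False
  then have y0: "0 < y" and x0: "0 < x" using y by auto
  have p: "0 < p" "p < 1" using log_2_3_bounds by (auto simp: p_def)
  define f where "f = (\<lambda>y. ln (1 + x powr p + x powr p * y powr p) - p * ln (1 + y))"
  \<comment> \<open>The sign of the derivative of \<open>f\<close>. It is antitone in y because p <
    1, which makes \<open>f\<close> unimodal.\<close>
  define N where "N = (\<lambda>y. x powr p * y powr (p - 1) - 1 - x powr p)"
  have pos: "0 < 1 + x powr p + x powr p * y powr p" for y by (simp add: add_pos_nonneg)
  have deriv: "(f has_real_derivative p * N y / ((1 + x powr p + x powr p * y powr p) * (1 + y))) (at y)"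
    if "0 < y" for y
  proof -
    have "(f has_real_derivative
        x powr p * (p * y powr (p - 1)) / (1 + x powr p + x powr p * y powr p) - p / (1 + y)) (at y)"
      unfolding f_def using pos[of y] that
      by (auto intro!: derivative_eq_intros simp: field_simps)
    moreover have "y powr p = y * y powr (p - 1)"
      using that by (simp add: powr_diff)
    then have "N y = x powr p * y powr (p - 1) * (1 + y) - (1 + x powr p + x powr p * y powr p)"
      unfolding N_def by (simp add: algebra_simps)
    ultimately show ?thesis
      using pos[of y] that by (simp add: divide_simps) (simp add: algebra_simps)
  qed
  have Nmono: "N b \<le> N a" if "0 < a" "a \<le> b" for a b
    unfolding N_def using powr_mono2'[of "p - 1" a b] that p by (simp add: mult_left_mono)
  \<comment> \<open>The derivative is available only for positive y; continuity carries the
    monotonicity to the endpoint 0.\<close>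
  have cont: "continuous_on {0..} f"
    unfolding f_def using pos p
    by (intro continuous_intros continuous_on_powr') (auto simp: less_imp_neq[symmetric])
  have end0: "p * ln (1 + x) \<le> f 0"
  proof -
    have "ln ((1 + x) powr p) \<le> ln (1 + x powr p)"
      using add_powr_le[of 1 x p] p x0 by (subst ln_le_cancel_iff) (auto simp: add_pos_nonneg)
    then show ?thesis using x0 p by (simp add: f_def ln_powr)
  qed
  have endx: "p * ln (1 + x) \<le> f x"
  proof -
    have "(1 + x) powr (p + p) \<le> 1 + x powr p + x powr p * x powr p"
      using one_plus_powr_log_2_3_le[OF x0] by (simp add: p_def flip: powr_add)
    then have "ln ((1 + x) powr (p + p)) \<le> ln (1 + x powr p + x powr p * x powr p)"
      using x0 pos[of x] by (subst ln_le_cancel_iff) auto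
    then show ?thesis using x0 by (simp add: f_def ln_powr algebra_simps)
  qed
  have "p * ln (1 + x) \<le> f y"
  proof (cases "0 \<le> N y")
    case True
    have "f 0 \<le> f y"
    proof (rule DERIV_nonneg_imp_increasing_open[OF y(1)])
      show "continuous_on {0..y} f" using cont by (rule continuous_on_subset) auto
      fix z assume z: "0 < z" "z < y"
      then have "0 \<le> N z" using True Nmono[of z y] by simp
      then have "0 \<le> p * N z / ((1 + x powr p + x powr p * z powr p) * (1 + z))"
        using p z by auto
      then show "\<exists>d. (f has_real_derivative d) (at z) \<and> 0 \<le> d" using deriv z by blast
    qed
    then show ?thesis using end0 by simp
  next
    case False
    have "f x \<le> f y"
    proof (rule DERIV_nonpos_imp_nonincreasing[OF y(2)])
      fix z assume z: "y \<le> z" "z \<le> x"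
      then have "N z \<le> 0" using False Nmono[of y z] y0 by simp
      then have "p * N z / ((1 + x powr p + x powr p * z powr p) * (1 + z)) \<le> 0"
        using p z y0 by (intro divide_nonpos_nonneg mult_nonneg_nonpos) auto
      then show "\<exists>d. (f has_real_derivative d) (at z) \<and> d \<le> 0" using deriv[of z] z y0 by force
    qed
    then show ?thesis using endx by simp
  qed
  then have "exp (p * ln (1 + x) + p * ln (1 + y)) \<le> exp (ln (1 + x powr p + x powr p * y powr p))"
    by (subst exp_le_cancel_iff) (simp add: f_def)
  then show ?thesis
    using x0 y0 pos[of y] by (simp add: powr_mult exp_add powr_def[of "1 + x"] powr_def[of "1 + y"])
qed

text \<open>By homogeneity the factor (a c)^p splits off, leaving x = b / a and y = d / c; the
  hypothesis a d \<le> b c becomes y \<le> x.\<close>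

lemma woodall_inequality:
  fixes a b c d :: real
  defines "p \<equiv> log 2 3 / 2"
  assumes nonneg: "0 \<le> a" "0 \<le> b" "0 \<le> c" "0 \<le> d" and le: "a * d \<le> b * c"
  shows "((a + b) * (c + d)) powr p \<le> (a * c) powr p + (b * d) powr p + (b * c) powr p"
proof -
  have p: "0 < p" "p < 1" using log_2_3_bounds by (auto simp: p_def)
  \<comment> \<open>For c = 0 the hypothesis reads a d \<le> 0, which forces a = 0 or d = 0.\<close>
  consider "a = 0" | "d = 0" "c = 0" | "0 < a" "0 < c"
    using nonneg le by (cases "a = 0"; cases "c = 0") (auto simp: mult_le_0_iff)
  then show ?thesis
  proof cases
    case 1
    then show ?thesis
      using add_powr_le[of "b * d" "b * c" p] p nonneg by (simp add: distrib_left add.commute)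
  next
    case 3
    define x y where "x = b / a" and "y = d / c"
    have b: "b = a * x" and d: "d = c * y" using 3 by (auto simp: x_def y_def)
    have xy: "0 \<le> y" "y \<le> x" using 3 nonneg le by (auto simp: x_def y_def field_simps)
    have "((a + b) * (c + d)) powr p = (a * c) powr p * ((1 + x) * (1 + y)) powr p"
      unfolding b d using 3 xy by (subst powr_mult[symmetric]) (auto simp: algebra_simps)
    also have "\<dots> \<le> (a * c) powr p * (1 + x powr p + (x * y) powr p)"
      using woodall_normalized[OF xy] by (intro mult_left_mono) (auto simp: p_def)
    also have "\<dots> = (a * c) powr p + ((a * c) * x) powr p + ((a * c) * (x * y)) powr p"
      using 3 xy by (simp add: powr_mult algebra_simps)
    finally show ?thesis unfolding b d by (simp add: mult_ac)
  qed auto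
qed

section \<open>The cube and its difference set\<close>

definition minus_set :: "real set \<Rightarrow> real set \<Rightarrow> real set" where
  "minus_set X Y = (\<lambda>(x, y). x - y) ` (X \<times> Y)"

lemma difference_set_eq_minus_set: "difference_set A = minus_set A A"
  by (auto simp: difference_set_def minus_set_def)

lemma finite_minus_set: "finite X \<Longrightarrow> finite Y \<Longrightarrow> finite (minus_set X Y)"
  by (simp add: minus_set_def)

text \<open>The subset sums of \<open>1, 3, \<dots>, 3 ^ (m - 1)\<close>: a copy of the cube \<open>{0,1} ^ m\<close> whose
  difference set is a copy of \<open>{-1,0,1} ^ m\<close>.\<close>

fun cube :: "nat \<Rightarrow> real set" where
  "cube 0 = {0}"
| "cube (Suc m) = cube m \<union> (+) (3 ^ m) ` cube m"

lemma finite_cube [simp]: "finite (cube m)"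
  by (induction m) auto

text \<open>The largest element is (3^m - 1) / 2. Differences therefore stay strictly within 3^m / 2
  of 0, which keeps translates by multiples of 3^m apart.\<close>

lemma cube_bounds: "x \<in> cube m \<Longrightarrow> 0 \<le> x \<and> 2 * x < 3 ^ m"
proof (induction m arbitrary: x)
  case (Suc m)
  then show ?case by fastforce
qed auto

lemma cube_shift_notin: "x \<in> cube m \<Longrightarrow> 3 ^ m + x \<notin> cube m"
  using cube_bounds[of x m] cube_bounds[of "3 ^ m + x" m] by auto

lemma card_cube: "card (cube m) = 2 ^ m"
proof (induction m)
  case (Suc m)
  have "card (cube (Suc m)) = card (cube m) + card ((+) (3 ^ m) ` cube m)"
    unfolding cube.simps using cube_shift_notin by (intro card_Un_disjoint) auto
  then show ?case using Suc by (simp add: card_image)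
qed simp

text \<open>The top digits differ by 0, 1 or -1, so three translates of the previous difference set
  cover the next one.\<close>

lemma card_minus_set_cube_le: "card (minus_set (cube m) (cube m)) \<le> 3 ^ m"
proof (induction m)
  case (Suc m)
  let ?D = "minus_set (cube m) (cube m)"
  have "minus_set (cube (Suc m)) (cube (Suc m)) \<subseteq> ?D \<union> (+) (3 ^ m) ` ?D \<union> (+) (- (3 ^ m)) ` ?D"
    (is "_ \<subseteq> ?R")
  proof
    fix z assume "z \<in> minus_set (cube (Suc m)) (cube (Suc m))"
    then obtain x y where z: "z = x - y" "x \<in> cube (Suc m)" "y \<in> cube (Suc m)"
      by (auto simp: minus_set_def)
    have D: "u - v \<in> ?D" if "u \<in> cube m" "v \<in> cube m" for u v
      using that by (auto simp: minus_set_def)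
    from z(2,3) consider "x \<in> cube m" "y \<in> cube m"
      | u where "x = 3 ^ m + u" "u \<in> cube m" "y \<in> cube m"
      | v where "x \<in> cube m" "y = 3 ^ m + v" "v \<in> cube m"
      | u v where "x = 3 ^ m + u" "u \<in> cube m" "y = 3 ^ m + v" "v \<in> cube m"
      by auto
    then show "z \<in> ?R"
    proof cases
      case 1
      then show ?thesis using D z by auto
    next
      case (2 u)
      then have "z = 3 ^ m + (u - y)" "u - y \<in> ?D" using D z by auto
      then show ?thesis by blast
    next
      case (3 v)
      then have "z = - (3 ^ m) + (x - v)" "x - v \<in> ?D" using D z by auto
      then show ?thesis by blast
    next
      case (4 u v)
      then show ?thesis using D[of u v] z by auto
    qed
  qed
  then have "card (minus_set (cube (Suc m)) (cube (Suc m))) \<le> card ?R"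
    by (intro card_mono) (auto intro!: finite_minus_set finite_imageI)
  also have "\<dots> \<le> card ?D + card ?D + card ?D"
    by (intro order_trans[OF card_Un_le] add_mono) (auto intro!: card_image_le finite_minus_set)
  finally show ?case using Suc by simp
qed (simp add: minus_set_def)

section \<open>Slicing by the top ternary digit\<close>

lemma card_cube_split:
  assumes "X \<subseteq> cube (Suc m)"
  shows "card X = card (X \<inter> cube m) + card {x \<in> cube m. 3 ^ m + x \<in> X}"
proof -
  let ?X1 = "{x \<in> cube m. 3 ^ m + x \<in> X}"
  have "X = (X \<inter> cube m) \<union> (+) (3 ^ m) ` ?X1" using assms by auto
  then have "card X = card ((X \<inter> cube m) \<union> (+) (3 ^ m) ` ?X1)" by simp
  also have "\<dots> = card (X \<inter> cube m) + card ((+) (3 ^ m) ` ?X1)"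
    using cube_shift_notin by (intro card_Un_disjoint) auto
  finally show ?thesis by (simp add: card_image)
qed

text \<open>Differences z with top digit 1, -1 and 0 satisfy 2 z > 3^m, 2 z < -3^m and \<bar>2
  z\<bar> < 3^m respectively, so they are disjoint. The two sets with top digit 0 may overlap; only
  one of them, \<open>M\<close>, is counted.\<close>

lemma card_minus_set_split:
  assumes "X0 \<subseteq> cube m" "X1 \<subseteq> cube m" "Y0 \<subseteq> cube m" "Y1 \<subseteq> cube m" "finite X" "finite Y"
    and X: "X0 \<subseteq> X" "(+) (3 ^ m) ` X1 \<subseteq> X" and Y: "Y0 \<subseteq> Y" "(+) (3 ^ m) ` Y1 \<subseteq> Y"
    and M: "M = minus_set X0 Y0 \<or> M = minus_set X1 Y1"
  shows "card (minus_set X1 Y0) + card (minus_set X0 Y1) + card M \<le> card (minus_set X Y)"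
proof -
  have small: "\<bar>2 * z\<bar> < 3 ^ m" if zUV: "z \<in> minus_set U V" "U \<subseteq> cube m" "V \<subseteq> cube m" for z U V
  proof -
    obtain u v where uv: "z = u - v" "u \<in> cube m" "v \<in> cube m"
      using zUV by (auto simp: minus_set_def)
    show ?thesis using cube_bounds[OF uv(2)] cube_bounds[OF uv(3)] uv(1) by (simp add: abs_less_iff)
  qed
  have fin: "finite (minus_set U V)" if "U \<subseteq> cube m" "V \<subseteq> cube m" for U V
    using that finite_cube finite_subset finite_minus_set by metis
  let ?P = "(+) (3 ^ m) ` minus_set X1 Y0" and ?N = "(+) (- (3 ^ m)) ` minus_set X0 Y1"
  have P: "3 ^ m < 2 * z" if "z \<in> ?P" for z
    using that small[of _ X1 Y0] assms by fastforce
  have N: "2 * z < - (3 ^ m)" if "z \<in> ?N" for z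
    using that small[of _ X0 Y1] assms by fastforce
  have M': "- (3 ^ m) < 2 * z \<and> 2 * z < 3 ^ m" if "z \<in> M" for z
    using M that small[of z X0 Y0] small[of z X1 Y1] assms by (auto simp: abs_less_iff)
  have finM: "finite M" using M fin assms by auto
  have sub: "?P \<union> ?N \<union> M \<subseteq> minus_set X Y"
  proof -
    have mem: "z \<in> minus_set X Y" if "z = x - y" "x \<in> X" "y \<in> Y" for x y z
      using that by (auto simp: minus_set_def)
    have "?P \<subseteq> minus_set X Y"
    proof
      fix z assume "z \<in> ?P"
      then obtain x y where "z = (3 ^ m + x) - y" "x \<in> X1" "y \<in> Y0" by (auto simp: minus_set_def)
      then show "z \<in> minus_set X Y" using X Y by (intro mem) auto
    qed
    moreover have "?N \<subseteq> minus_set X Y"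
    proof
      fix z assume "z \<in> ?N"
      then obtain x y where "z = x - (3 ^ m + y)" "x \<in> X0" "y \<in> Y1" by (auto simp: minus_set_def)
      then show "z \<in> minus_set X Y" using X Y by (intro mem) auto
    qed
    moreover have "minus_set X0 Y0 \<subseteq> minus_set X Y" using X Y by (auto simp: minus_set_def)
    moreover have "minus_set X1 Y1 \<subseteq> minus_set X Y"
    proof
      fix z assume "z \<in> minus_set X1 Y1"
      then obtain x y where "z = (3 ^ m + x) - (3 ^ m + y)" "x \<in> X1" "y \<in> Y1"
        by (auto simp: minus_set_def)
      then show "z \<in> minus_set X Y" using X Y mem[of z "3 ^ m + x" "3 ^ m + y"]
        by (simp add: image_subset_iff)
    qed
    ultimately show ?thesis using M by auto
  qed
  have "?P \<inter> ?N = {}" using P N by (force dest: order.strict_trans)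
  moreover have "(?P \<union> ?N) \<inter> M = {}" using P N M' by (force dest: order.strict_trans)
  ultimately have "card (?P \<union> ?N \<union> M) = card ?P + card ?N + card M"
    using fin finM assms by (simp add: card_Un_disjoint)
  moreover have "card (?P \<union> ?N \<union> M) \<le> card (minus_set X Y)"
    using sub assms by (intro card_mono finite_minus_set)
  ultimately show ?thesis by (simp add: card_image)
qed

text \<open>Two sets are allowed because the induction meets differences of unequal slices, such as
  \<open>X1\<close> and \<open>Y0\<close>.\<close>

lemma card_minus_set_cube_ge:
  assumes "X \<subseteq> cube m" "Y \<subseteq> cube m"
  shows "(real (card X) * real (card Y)) powr (log 2 3 / 2) \<le> real (card (minus_set X Y))"
  using assms
proof (induction m arbitrary: X Y)
  case 0
  then consider "X = {} \<or> Y = {}" | "X = {0}" "Y = {0}" by auto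
  then show ?case by cases (auto simp: minus_set_def)
next
  case (Suc m)
  define p :: real where "p = log 2 3 / 2"
  define X0 X1 Y0 Y1 where "X0 = X \<inter> cube m" and "X1 = {x \<in> cube m. 3 ^ m + x \<in> X}"
    and "Y0 = Y \<inter> cube m" and "Y1 = {y \<in> cube m. 3 ^ m + y \<in> Y}"
  note defs = X0_def X1_def Y0_def Y1_def
  have sub: "X0 \<subseteq> cube m" "X1 \<subseteq> cube m" "Y0 \<subseteq> cube m" "Y1 \<subseteq> cube m"
    by (auto simp: defs)
  have cX: "real (card X) = real (card X0) + real (card X1)"
    using card_cube_split[OF Suc.prems(1)] by (simp add: defs)
  have cY: "real (card Y) = real (card Y0) + real (card Y1)"
    using card_cube_split[OF Suc.prems(2)] by (simp add: defs)
  have split: "real (card (minus_set X1 Y0)) + real (card (minus_set X0 Y1)) + real (card M)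
      \<le> real (card (minus_set X Y))" if "M = minus_set X0 Y0 \<or> M = minus_set X1 Y1" for M
  proof -
    have "finite X" "finite Y" using Suc.prems finite_cube finite_subset by blast+
    then have "card (minus_set X1 Y0) + card (minus_set X0 Y1) + card M \<le> card (minus_set X Y)"
      using sub that by (intro card_minus_set_split[of X0 m X1 Y0 Y1]) (auto simp: defs)
    then show ?thesis by linarith
  qed
  note IH = Suc.IH[folded p_def]
  have "(real (card X) * real (card Y)) powr p \<le> real (card (minus_set X Y))"
  \<comment> \<open>The middle piece is taken from the pair of slices with the larger product. This
    comparison is the hypothesis a d \<le> b c of Woodall's inequality, with the slices of
    \<open>Y\<close> in the opposite order to those of \<open>X\<close>.\<close>
  proof (cases "card X0 * card Y0 \<le> card X1 * card Y1")
    case True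
    then have "real (card X0) * real (card Y0) \<le> real (card X1) * real (card Y1)"
      by (metis of_nat_le_iff of_nat_mult)
    then have "((real (card X0) + real (card X1)) * (real (card Y1) + real (card Y0))) powr p
      \<le> (real (card X0) * real (card Y1)) powr p + (real (card X1) * real (card Y0)) powr p
        + (real (card X1) * real (card Y1)) powr p"
      unfolding p_def by (intro woodall_inequality) auto
    then show ?thesis
      using IH[OF sub(1,4)] IH[OF sub(2,3)] IH[OF sub(2,4)] split[of "minus_set X1 Y1"]
      unfolding cX cY by (simp add: add.commute)
  next
    case False
    then have "real (card X1) * real (card Y1) \<le> real (card X0) * real (card Y0)"
      by (metis of_nat_le_iff of_nat_mult nat_le_linear)
    then have "((real (card X1) + real (card X0)) * (real (card Y0) + real (card Y1))) powr p
      \<le> (real (card X1) * real (card Y0)) powr p + (real (card X0) * real (card Y1)) powr p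
        + (real (card X0) * real (card Y0)) powr p"
      unfolding p_def by (intro woodall_inequality) auto
    then show ?thesis
      using IH[OF sub(1,4)] IH[OF sub(2,3)] IH[OF sub(1,3)] split[of "minus_set X0 Y0"]
      unfolding cX cY by (simp add: add.commute)
  qed
  then show ?case by (simp add: p_def)
qed

section \<open>The cube as a witness for the bound on \<open>g\<close>\<close>

lemma admissible_cube: "admissible (2 ^ m) k (real k powr log 2 3) (cube m)"
  unfolding admissible_def
proof (intro conjI allI impI)
  fix A assume A: "A \<subseteq> cube m \<and> card A = k"
  \<comment> \<open>This is the lower bound for the pair (A, A), whose product of cardinalities is
    k^2.\<close>
  have "real k powr log 2 3 = (real k * real k) powr (log 2 3 / 2)"
    by (simp add: powr_mult flip: powr_add)
  then show "real k powr log 2 3 \<le> real (card (difference_set A))"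
    using card_minus_set_cube_ge[of A m A] A by (simp add: difference_set_eq_minus_set)
qed (simp_all add: card_cube)

theorem theorem1p2:
  fixes n k :: nat
  assumes "k < n"
    and "\<exists>m::nat. n = 2 ^ m"
  shows "ereal_of_enat (g n k (real k powr log 2 3)) \<le> ereal (real n powr log 2 3)"
proof -
  obtain m where n: "n = 2 ^ m" using assms by blast
  have "g n k (real k powr log 2 3) \<le> enat (card (difference_set (cube m)))"
    unfolding g_def n using admissible_cube by (intro INF_lower) simp
  also have "\<dots> \<le> enat (3 ^ m)"
    using card_minus_set_cube_le by (simp add: difference_set_eq_minus_set)
  finally have "ereal_of_enat (g n k (real k powr log 2 3)) \<le> ereal_of_enat (enat (3 ^ m))"
    by (simp only: ereal_of_enat_le_iff)
  also have "real n powr log 2 3 = 3 ^ m"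
  proof -
    \<comment> \<open>Exchanging the exponents m and log 2 3 leaves a power of 2 powr log 2 3, that
      is of 3.\<close>
    have "real n powr log 2 3 = (2 powr log 2 3) powr real m"
      unfolding n powr_powr by (simp add: powr_powr mult.commute flip: powr_realpow del: powr_log_cancel)
    then show ?thesis by (simp add: powr_realpow)
  qed
  then have "ereal_of_enat (enat (3 ^ m)) = ereal (real n powr log 2 3)" by simp
  finally show ?thesis .
qed

end
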